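(* Let $\hat{A}\in\mathbb{DC}_n^{\mathrm{CM}}$ with $r=\operatorname{Rank}(\hat A)$ have the form $$\hat{A}=\hat{U}\begin{bmatrix}\Sigma_1K&\Sigma_1L\\0&0\end{bmatrix}\hat{U}^*,$$ where $\hat U\in\mathbb{DC}_n^U$, $K\in\mathbb{DC}^{r\times r}$, $L\in\mathbb{DC}^{r\times(n-r)}$ satisfy $KK^*+LL^*=I_r$, and $\Sigma_1=\operatorname{diag}(\mu_1,\ldots,\mu_r)$ with $\mu_1\ge\cdots\ge\mu_r$ positive appreciable dual numbers. Then the following statements hold: (a) $\hat{A}=\hat{A}^{\#}$ if and only if $(\Sigma_1K)^2=I_r$; (b) $\hat{A}=\hat{A}^{\mathrm{core}}$ if and only if $L=0$ and $(\Sigma_1K)^2=I_r$; (c) $\hat{A}^*=\hat{A}^{\#}$ if and only if $L=0$ and $\Sigma_1=I_r$; (d) $\hat{A}^*=\hat{A}^{\mathrm{core}}$ if and only if $L=0$ and $\Sigma_1=I_r$.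
   Context: Dual complex numbers are $\hat a=a_s+\epsilon a_d$ with $a_s,a_d\in\mathbb{C}$, $\epsilon\ne0$, $\epsilon^2=0$, $\epsilon$ commuting with scalars; they form the ring $\mathbb{DC}$. A dual number is such an element with $a_s,a_d\in\mathbb{R}$. It is appreciable if $a_s\neq0$ and infinitesimal if $a_s=0$. Dual numbers are totally ordered by: $\hat a\le\hat b$ iff $a_s<b_s$, or $a_s=b_s$ and $a_d\le b_d$; $\hat a$ is positive if $\hat a>0$. A matrix $\hat A\in\mathbb{DC}^{m\times n}$ is written $\hat A=A_s+\epsilon A_d$ with $A_s,A_d\in\mathbb{C}^{m\times n}$; $\hat A^*=A_s^*+\epsilon A_d^*$. $\mathbb{DC}_n^U$ is the set of $\hat U\in\mathbb{DC}^{n\times n}$ with $\hat U^{-1}=\hat U^*$. Dual SVD: every $\hat A\in\mathbb{DC}^{m\times n}$ can be written $\hat A=\hat P\begin{bmatrix}\Sigma_0&0\\0&0\end{bmatrix}\hat V^*$ with $\hat P\in\mathbb{DC}_m^U$, $\hat V\in\mathbb{DC}_n^U$, $\Sigma_0=\operatorname{diag}(\mu_1,\ldots,\mu_t)$ with positive dual number entries in nonincreasing order (appreciable ones first, then infinitesimal ones), where $\Sigma_0$ is uniquely determined by $\hat A$; $\operatorname{Rank}(\hat A)=t$. $\mathbb{DC}_n^{\mathrm{CM}}=\{\hat A\in\mathbb{DC}^{n\times n}:\mathcal R(\hat A^2)=\mathcal R(\hat A)\}$, where $\mathcal R(\hat A)=\{\hat Ax:x\in\mathbb{DC}^n\}$.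 For $\hat A\in\mathbb{DC}_n^{\mathrm{CM}}$: the dual group inverse $\hat A^{\#}$ is the unique $\hat X$ with $\hat A\hat X\hat A=\hat A$, $\hat X\hat A\hat X=\hat X$, $\hat A\hat X=\hat X\hat A$; the dual core generalized inverse $\hat A^{\mathrm{core}}$ is the unique $\hat X$ with $\hat A\hat X\hat A=\hat A$, $\hat A\hat X^2=\hat X$, $(\hat A\hat X)^*=\hat A\hat X$. *)

theory Defs
  imports "Jordan_Normal_Form.Matrix"
begin

text \<open>\<open>Dual a b\<close> stands for \<open>a + \<epsilon> b\<close> with \<open>\<epsilon>\<^sup>2 = 0\<close>. Dual numbers are the elements
  of \<open>real dual\<close>, dual complex numbers those of \<open>complex dual\<close>.\<close>

datatype 'a dual = Dual (std_part: 'a) (inf_part: 'a)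

instantiation dual :: (comm_ring_1) comm_ring_1
begin

definition "0 = Dual 0 0"
definition "1 = Dual 1 0"
definition "x + y = Dual (std_part x + std_part y) (inf_part x + inf_part y)"
definition "x - y = Dual (std_part x - std_part y) (inf_part x - inf_part y)"
definition "- x = Dual (- std_part x) (- inf_part x)"
definition "x * y = Dual (std_part x * std_part y)
  (std_part x * inf_part y + inf_part x * std_part y)"

instance
  by standard
    (simp_all add: zero_dual_def one_dual_def plus_dual_def minus_dual_def uminus_dual_def
      times_dual_def algebra_simps)

end

instantiation dual :: (linorder) linorder
begin

definition "x \<le> y \<longleftrightarrow>
  std_part x < std_part y \<or> std_part x = std_part y \<and> inf_part x \<le> inf_part y"
definition "(x :: 'a dual) < y \<longleftrightarrow> x \<le> y \<and> x \<noteq> y"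

instance
  by standard (auto simp: less_eq_dual_def less_dual_def intro: dual.expand)

end

instantiation dual :: ("{comm_ring_1, conjugatable_ring}") conjugatable_ring
begin

definition "conjugate x = Dual (conjugate (std_part x)) (conjugate (inf_part x))"

instance
  by standard
    (auto simp: conjugate_dual_def zero_dual_def plus_dual_def uminus_dual_def times_dual_def
      conjugate_dist_mul conjugate_dist_add conjugate_neg intro: dual.expand)

end

definition appreciable :: "'a::zero dual \<Rightarrow> bool" where
  "appreciable x \<longleftrightarrow> std_part x \<noteq> 0"

definition dc_adjoint :: "complex dual mat \<Rightarrow> complex dual mat" where
  "dc_adjoint A = map_mat conjugate (transpose_mat A)"

definition dc_unitary :: "nat \<Rightarrow> complex dual mat set" where
  "dc_unitary n = {U \<in> carrier_mat n n.
     inverts_mat U (dc_adjoint U) \<and> inverts_mat (dc_adjoint U) U}"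

text \<open>The diagonal matrix of the dual numbers \<open>\<mu> 0, \<dots>, \<mu> (t - 1)\<close>, which are embedded into
  the dual complex numbers; sequences of singular values are indexed from \<open>0\<close>.\<close>

definition dual_diag :: "nat \<Rightarrow> (nat \<Rightarrow> real dual) \<Rightarrow> complex dual mat" where
  "dual_diag t \<mu> = mat_diag t (\<lambda>i. map_dual complex_of_real (\<mu> i))"

text \<open>Since the order is lexicographic, nonincreasing positive values automatically list the
  appreciable ones before the infinitesimal ones.\<close>

definition dual_svd :: "complex dual mat \<Rightarrow> complex dual mat \<Rightarrow> nat \<Rightarrow> (nat \<Rightarrow> real dual) \<Rightarrow>
    complex dual mat \<Rightarrow> bool" where
  "dual_svd A P t \<mu> V \<longleftrightarrow>
     P \<in> dc_unitary (dim_row A) \<and> V \<in> dc_unitary (dim_col A) \<and>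
     t \<le> dim_row A \<and> t \<le> dim_col A \<and>
     (\<forall>i<t. 0 < \<mu> i) \<and> (\<forall>i j. i \<le> j \<longrightarrow> j < t \<longrightarrow> \<mu> j \<le> \<mu> i) \<and>
     A = P * four_block_mat (dual_diag t \<mu>) (0\<^sub>m t (dim_col A - t))
               (0\<^sub>m (dim_row A - t) t) (0\<^sub>m (dim_row A - t) (dim_col A - t)) * dc_adjoint V"

definition dual_rank :: "complex dual mat \<Rightarrow> nat" where
  "dual_rank A = (THE t. \<exists>P \<mu> V. dual_svd A P t \<mu> V)"

definition dc_range :: "complex dual mat \<Rightarrow> complex dual vec set" where
  "dc_range A = {A *\<^sub>v x |x. x \<in> carrier_vec (dim_col A)}"

definition dc_CM :: "nat \<Rightarrow> complex dual mat set" where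
  "dc_CM n = {A \<in> carrier_mat n n. dc_range (A ^\<^sub>m 2) = dc_range A}"

definition dual_group_inverse :: "complex dual mat \<Rightarrow> complex dual mat" where
  "dual_group_inverse A = (THE X. X \<in> carrier_mat (dim_row A) (dim_row A) \<and>
     A * X * A = A \<and> X * A * X = X \<and> A * X = X * A)"

definition dual_core_inverse :: "complex dual mat \<Rightarrow> complex dual mat" where
  "dual_core_inverse A = (THE X. X \<in> carrier_mat (dim_row A) (dim_row A) \<and>
     A * X * A = A \<and> A * X ^\<^sub>m 2 = X \<and> dc_adjoint (A * X) = A * X)"

end

theory Submission
  imports Defs "Jordan_Normal_Form.Determinant"
begin

text \<open>The range condition forces \<open>S K\<close> to be right invertible, hence invertible. With
  \<open>B = S K\<close> and \<open>C = S L\<close>, the group inverse and the core inverse of the block matrix with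
  upper row \<open>(B, C)\<close> are then explicit, and both inverses are unique; so each of the four
  statements says that the defining equations of the inverse hold for \<open>X = A\<close> or
  \<open>X = A\<^sup>*\<close>. Unitary conjugation reduces these equations to the block matrix itself.\<close>

section \<open>Matrices over commutative rings\<close>

lemma pow_mat_two:
  fixes A :: "'a::semiring_1 mat"
  assumes "A \<in> carrier_mat n n"
  shows "A ^\<^sub>m 2 = A * A"
  using assms by (simp add: numeral_2_eq_2)

text \<open>Dual complex numbers have zero divisors, so the argument uses determinants over a
  commutative ring: \<open>det A\<close> is a unit with inverse \<open>det B\<close>, and the
  adjugate of \<open>A\<close> scaled by \<open>det B\<close> is a left inverse, which must equal
  \<open>B\<close>.\<close>

lemma right_inverse_imp_left_inverse_mat:
  fixes A B :: "'a::comm_ring_1 mat"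
  assumes A: "A \<in> carrier_mat n n" and B: "B \<in> carrier_mat n n" and AB: "A * B = 1\<^sub>m n"
  shows "B * A = 1\<^sub>m n"
proof -
  define C where "C = det B \<cdot>\<^sub>m adj_mat A"
  have C: "C \<in> carrier_mat n n"
    using adj_mat(1)[OF A] by (simp add: C_def)
  have "det A * det B = 1"
    using det_mult[OF A B] AB by simp
  then have "det B * det A = 1"
    by (simp add: mult.commute)
  moreover have "C * A = (det B * det A) \<cdot>\<^sub>m 1\<^sub>m n"
    using adj_mat[OF A] A by (auto simp: C_def mult_smult_assoc_mat[of _ n n _ n])
  ultimately have CA: "C * A = 1\<^sub>m n"
    by auto
  have "C = C * (A * B)"
    using AB C by simp
  also have "\<dots> = B"
    using assoc_mult_mat[OF C A B] CA B by simp
  finally show ?thesis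
    using CA by simp
qed

lemma mult_left_cancel_mat:
  fixes A :: "'a::semiring_1 mat"
  assumes "A \<in> carrier_mat n n" "T \<in> carrier_mat n n" "T * A = 1\<^sub>m n"
    and "X \<in> carrier_mat n m" "Y \<in> carrier_mat n m" "A * X = A * Y"
  shows "X = Y"
proof -
  have "T * A * X = T * A * Y"
    by (simp only: assoc_mult_mat[OF assms(2,1,4)] assoc_mult_mat[OF assms(2,1,5)] assms(6))
  then show ?thesis
    using assms(3-5) by simp
qed

lemma mult_right_cancel_mat:
  fixes A :: "'a::semiring_1 mat"
  assumes "A \<in> carrier_mat n n" "T \<in> carrier_mat n n" "A * T = 1\<^sub>m n"
    and "X \<in> carrier_mat m n" "Y \<in> carrier_mat m n" "X * A = Y * A"
  shows "X = Y"
proof -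
  have "X * (A * T) = Y * (A * T)"
    by (simp only: assms(6) flip: assoc_mult_mat[OF assms(4,1,2)] assoc_mult_mat[OF assms(5,1,2)])
  then show ?thesis
    using assms(3-5) by simp
qed

section \<open>Block matrices with a zero block row or block column\<close>

lemma four_block_mat_eq_iff:
  assumes "A \<in> carrier_mat a c" "B \<in> carrier_mat a d" "C \<in> carrier_mat b c" "D \<in> carrier_mat b d"
    and "A' \<in> carrier_mat a c" "B' \<in> carrier_mat a d" "C' \<in> carrier_mat b c" "D' \<in> carrier_mat b d"
  shows "four_block_mat A B C D = four_block_mat A' B' C' D' \<longleftrightarrow>
    A = A' \<and> B = B' \<and> C = C' \<and> D = D'" (is "?F = ?F' \<longleftrightarrow> _")
proof
  assume eq: "?F = ?F'"
  have ent: "?F $$ (i, j) = ?F' $$ (i, j)" for i j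
    using eq by simp
  have "A = A'"
  proof (rule eq_matI)
    fix i j assume "i < dim_row A'" "j < dim_col A'"
    then show "A $$ (i, j) = A' $$ (i, j)"
      using ent[of i j] assms by auto
  qed (use assms in auto)
  moreover have "B = B'"
  proof (rule eq_matI)
    fix i j assume "i < dim_row B'" "j < dim_col B'"
    then show "B $$ (i, j) = B' $$ (i, j)"
      using ent[of i "c + j"] assms by auto
  qed (use assms in auto)
  moreover have "C = C'"
  proof (rule eq_matI)
    fix i j assume "i < dim_row C'" "j < dim_col C'"
    then show "C $$ (i, j) = C' $$ (i, j)"
      using ent[of "a + i" j] assms by auto
  qed (use assms in auto)
  moreover have "D = D'"
  proof (rule eq_matI)
    fix i j assume "i < dim_row D'" "j < dim_col D'"
    then show "D $$ (i, j) = D' $$ (i, j)"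
      using ent[of "a + i" "c + j"] assms by auto
  qed (use assms in auto)
  ultimately show "A = A' \<and> B = B' \<and> C = C' \<and> D = D'"
    by blast
qed auto

definition top_block :: "nat \<Rightarrow> nat \<Rightarrow> 'a::zero mat \<Rightarrow> 'a mat \<Rightarrow> 'a mat" where
  "top_block r m B C = four_block_mat B C (0\<^sub>m m r) (0\<^sub>m m m)"

definition left_block :: "nat \<Rightarrow> nat \<Rightarrow> 'a::zero mat \<Rightarrow> 'a mat \<Rightarrow> 'a mat" where
  "left_block r m B C = four_block_mat B (0\<^sub>m r m) C (0\<^sub>m m m)"

lemma top_block_carrier [simp]:
  "B \<in> carrier_mat r r \<Longrightarrow> top_block r m B C \<in> carrier_mat (r + m) (r + m)"
  by (simp add: top_block_def)

lemma left_block_carrier [simp]: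
  "B \<in> carrier_mat r r \<Longrightarrow> left_block r m B C \<in> carrier_mat (r + m) (r + m)"
  by (simp add: left_block_def)

lemma top_block_eq_iff:
  assumes "B \<in> carrier_mat r r" "C \<in> carrier_mat r m" "B' \<in> carrier_mat r r" "C' \<in> carrier_mat r m"
  shows "top_block r m B C = top_block r m B' C' \<longleftrightarrow> B = B' \<and> C = C'"
  using assms by (simp add: top_block_def four_block_mat_eq_iff[of _ r r _ m _ m])

text \<open>Since the adjoint of a \<open>top_block\<close> matrix is a \<open>left_block\<close>
  matrix, this turns Hermitian symmetry into the vanishing of the off-diagonal block.\<close>

lemma top_block_eq_left_block_iff:
  assumes "B \<in> carrier_mat r r" "C \<in> carrier_mat r m" "B' \<in> carrier_mat r r" "C' \<in> carrier_mat m r"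
  shows "top_block r m B C = left_block r m B' C' \<longleftrightarrow>
    B = B' \<and> C = 0\<^sub>m r m \<and> C' = 0\<^sub>m m r"
  using assms by (auto simp: top_block_def left_block_def four_block_mat_eq_iff[of _ r r _ m _ m])

text \<open>The zero rows at the bottom survive multiplication by any matrix on the right. This
  handles products with a factor of which only the size is known.\<close>

lemma top_block_mult_four_block:
  fixes B :: "'a::semiring_1 mat"
  assumes "B \<in> carrier_mat r r" "C \<in> carrier_mat r m"
    and "P \<in> carrier_mat r r" "Q \<in> carrier_mat r m" "R \<in> carrier_mat m r" "V \<in> carrier_mat m m"
  shows "top_block r m B C * four_block_mat P Q R V =
    top_block r m (B * P + C * R) (B * Q + C * V)"
  using assms
  by (simp add: top_block_def mult_four_block_mat[of _ r r _ m _ m _ _ r _ m])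

lemma top_block_mult_top_block:
  fixes B :: "'a::semiring_1 mat"
  assumes "B \<in> carrier_mat r r" "C \<in> carrier_mat r m" "B' \<in> carrier_mat r r" "C' \<in> carrier_mat r m"
  shows "top_block r m B C * top_block r m B' C' = top_block r m (B * B') (B * C')"
  using top_block_mult_four_block[of B r C m B' C' "0\<^sub>m m r" "0\<^sub>m m m"] assms
  by (simp add: top_block_def)

lemma top_block_mult_left_block:
  fixes B :: "'a::semiring_1 mat"
  assumes "B \<in> carrier_mat r r" "C \<in> carrier_mat r m" "B' \<in> carrier_mat r r" "C' \<in> carrier_mat m r"
  shows "top_block r m B C * left_block r m B' C' =
    top_block r m (B * B' + C * C') (0\<^sub>m r m)"
  using top_block_mult_four_block[of B r C m B' "0\<^sub>m r m" C' "0\<^sub>m m m"] assms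
  by (simp add: left_block_def)

lemma left_block_mult_top_block:
  fixes B :: "'a::semiring_1 mat"
  assumes "B \<in> carrier_mat r r" "C \<in> carrier_mat m r" "B' \<in> carrier_mat r r" "C' \<in> carrier_mat r m"
  shows "left_block r m B C * top_block r m B' C' =
    four_block_mat (B * B') (B * C') (C * B') (C * C')"
  using assms
  by (simp add: top_block_def left_block_def mult_four_block_mat[of _ r r _ m _ m _ _ r _ m])

section \<open>Adjoints and unitary conjugation\<close>

text \<open>Conjugation is a multiplicative involution, hence surjective, so the image of 1 is again
  neutral.\<close>

lemma conjugate_one [simp]: "conjugate (1 :: 'a::{comm_ring_1,conjugatable_ring}) = 1"
  by (metis conjugate_dist_mul conjugate_id mult.right_neutral mult.commute)

lemma dc_adjoint_carrier [simp]:
  "dc_adjoint A \<in> carrier_mat n m \<longleftrightarrow> A \<in> carrier_mat m n"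
  by (simp add: dc_adjoint_def)

lemma dc_adjoint_adjoint [simp]: "dc_adjoint (dc_adjoint A) = A"
  by (rule eq_matI) (auto simp: dc_adjoint_def)

lemma dc_adjoint_zero [simp]: "dc_adjoint (0\<^sub>m n m) = 0\<^sub>m m n"
  by (rule eq_matI) (auto simp: dc_adjoint_def)

lemma dc_adjoint_one [simp]: "dc_adjoint (1\<^sub>m n) = 1\<^sub>m n"
  by (rule eq_matI) (auto simp: dc_adjoint_def)

lemma dc_adjoint_mult:
  assumes A: "A \<in> carrier_mat n k" and B: "B \<in> carrier_mat k m"
  shows "dc_adjoint (A * B) = dc_adjoint B * dc_adjoint A"
proof (rule eq_matI)
  fix i j
  assume "i < dim_row (dc_adjoint B * dc_adjoint A)" "j < dim_col (dc_adjoint B * dc_adjoint A)"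
  then show "dc_adjoint (A * B) $$ (i, j) = (dc_adjoint B * dc_adjoint A) $$ (i, j)"
    using A B
    by (auto simp: dc_adjoint_def scalar_prod_def sum_conjugate conjugate_dist_mul mult.commute
        intro!: sum.cong)
qed (use A B in \<open>auto simp: dc_adjoint_def\<close>)

lemma dc_adjoint_top_block:
  assumes "B \<in> carrier_mat r r" "C \<in> carrier_mat r m"
  shows "dc_adjoint (top_block r m B C) = left_block r m (dc_adjoint B) (dc_adjoint C)"
  using assms
  by (intro eq_matI) (auto simp: dc_adjoint_def top_block_def left_block_def)

lemma dc_unitaryD:
  assumes "U \<in> dc_unitary n"
  shows "U \<in> carrier_mat n n" "U * dc_adjoint U = 1\<^sub>m n" "dc_adjoint U * U = 1\<^sub>m n"
  using assms by (auto simp: dc_unitary_def inverts_mat_def dc_adjoint_def)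

section \<open>Conjugation by a unitary matrix\<close>

definition unitary_conj :: "complex dual mat \<Rightarrow> complex dual mat \<Rightarrow> complex dual mat" where
  "unitary_conj U X = U * X * dc_adjoint U"

lemma unitary_conj_carrier [simp]:
  "U \<in> dc_unitary n \<Longrightarrow> X \<in> carrier_mat n n \<Longrightarrow> unitary_conj U X \<in> carrier_mat n n"
  using dc_unitaryD(1)[of U n] by (auto simp: unitary_conj_def)

text \<open>The inner factor \<open>dc_adjoint U * U\<close> cancels. By this and the two lemmas
  after it, conjugation is injective and preserves products and adjoints, so it transports the
  defining equations of both inverses.\<close>

lemma unitary_conj_mult:
  assumes U: "U \<in> dc_unitary n" and X: "X \<in> carrier_mat n n" and Y: "Y \<in> carrier_mat n n"
  shows "unitary_conj U X * unitary_conj U Y = unitary_conj U (X * Y)"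
proof -
  note U' = dc_unitaryD[OF U]
  have "unitary_conj U X * unitary_conj U Y =
      U * X * (dc_adjoint U * U) * (Y * dc_adjoint U)"
    using U'(1) X Y by (simp add: unitary_conj_def assoc_mult_mat[of _ n n _ n _ n])
  also have "\<dots> = unitary_conj U (X * Y)"
    unfolding U'(3) using U'(1) X Y by (simp add: unitary_conj_def assoc_mult_mat[of _ n n _ n _ n])
  finally show ?thesis .
qed

lemma unitary_conj_adjoint:
  assumes U: "U \<in> dc_unitary n" and X: "X \<in> carrier_mat n n"
  shows "dc_adjoint (unitary_conj U X) = unitary_conj U (dc_adjoint X)"
  using dc_unitaryD(1)[OF U] X
  by (simp add: unitary_conj_def dc_adjoint_mult[of _ n n _ n] assoc_mult_mat[of _ n n _ n _ n])

lemma unitary_conj_eq_iff: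
  assumes U: "U \<in> dc_unitary n" and X: "X \<in> carrier_mat n n" and Y: "Y \<in> carrier_mat n n"
  shows "unitary_conj U X = unitary_conj U Y \<longleftrightarrow> X = Y"
proof
  note U' = dc_unitaryD[OF U]
  have UX: "U * X \<in> carrier_mat n n" and UY: "U * Y \<in> carrier_mat n n"
    and A: "dc_adjoint U \<in> carrier_mat n n"
    using U'(1) X Y by auto
  assume "unitary_conj U X = unitary_conj U Y"
  then have "U * X = U * Y"
    unfolding unitary_conj_def using mult_right_cancel_mat[OF A U'(1,3) UX UY] by blast
  then show "X = Y"
    using mult_left_cancel_mat[OF U'(1) A U'(3) X Y] by blast
qed simp

section \<open>Group inverse and core inverse\<close>

definition is_group_inverse :: "nat \<Rightarrow> complex dual mat \<Rightarrow> complex dual mat \<Rightarrow> bool" where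
  "is_group_inverse n A X \<longleftrightarrow> X \<in> carrier_mat n n \<and>
     A * X * A = A \<and> X * A * X = X \<and> A * X = X * A"

text \<open>The square is spelled out as a product, so that \<open>unitary_conj_mult\<close> and the
  block product rules apply directly; \<open>pow_mat_two\<close> links it to the power in
  \<open>dual_core_inverse\<close>.\<close>

definition is_core_inverse :: "nat \<Rightarrow> complex dual mat \<Rightarrow> complex dual mat \<Rightarrow> bool" where
  "is_core_inverse n A X \<longleftrightarrow> X \<in> carrier_mat n n \<and>
     A * X * A = A \<and> A * (X * X) = X \<and> dc_adjoint (A * X) = A * X"

lemma is_group_inverseD:
  assumes "is_group_inverse n A X"
  shows "X \<in> carrier_mat n n" "A * X * A = A" "X * A * X = X" "A * X = X * A"
  using assms by (auto simp: is_group_inverse_def)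

lemma is_core_inverseD:
  assumes "is_core_inverse n A X"
  shows "X \<in> carrier_mat n n" "A * X * A = A" "A * (X * X) = X" "dc_adjoint (A * X) = A * X"
  using assms by (auto simp: is_core_inverse_def)

text \<open>First the idempotents \<open>A * X\<close> and \<open>A * Y\<close> coincide, because
  commutation lets \<open>A * X * A = A\<close> absorb one of them into the other. Then each inverse
  is recovered from the common idempotent by the equation \<open>X * A * X = X\<close>.\<close>

lemma is_group_inverse_unique:
  assumes A: "A \<in> carrier_mat n n" and X: "is_group_inverse n A X" and Y: "is_group_inverse n A Y"
  shows "X = Y"
proof -
  note assoc = assoc_mult_mat[of _ n n _ n _ n]
  have Xc: "X \<in> carrier_mat n n" and Yc: "Y \<in> carrier_mat n n"
    and X1: "A * X * A = A" and X2: "X * A * X = X" and X3: "A * X = X * A"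
    and Y1: "A * Y * A = A" and Y2: "Y * A * Y = Y" and Y3: "A * Y = Y * A"
    using is_group_inverseD[OF X] is_group_inverseD[OF Y] by auto
  have "A * X = A * Y * A * X"
    using Y1 by simp
  also have "\<dots> = (A * Y) * (A * X)"
    using A Xc Yc by (simp add: assoc)
  also have "\<dots> = (Y * A) * (X * A)"
    using X3 Y3 by simp
  also have "\<dots> = Y * (A * X * A)"
    using A Xc Yc by (simp add: assoc)
  finally have eq: "A * X = A * Y"
    using X1 Y3 by simp
  have "X = X * (A * X)"
    using X2 A Xc by (simp add: assoc)
  also have "\<dots> = X * A * Y"
    using eq A Xc Yc by (simp add: assoc)
  also have "\<dots> = A * X * Y"
    using X3 by simp
  also have "\<dots> = Y * A * Y"
    using eq Y3 by simp
  finally show ?thesis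
    using Y2 by simp
qed

text \<open>\<open>A * X\<close> and \<open>A * Y\<close> are Hermitian idempotents with the range
  of \<open>A\<close>, hence the same orthogonal projector. The group inverse then recovers
  \<open>X\<close> from \<open>A * X\<close>.\<close>

lemma is_core_inverse_unique:
  assumes A: "A \<in> carrier_mat n n" and G: "is_group_inverse n A G"
    and X: "is_core_inverse n A X" and Y: "is_core_inverse n A Y"
  shows "X = Y"
proof -
  note assoc = assoc_mult_mat[of _ n n _ n _ n]
  have Gc: "G \<in> carrier_mat n n" and G1: "A * G * A = A" and G3: "A * G = G * A"
    using G by (auto simp: is_group_inverse_def)
  \<comment> \<open>\<open>A * Q\<close> acts as the identity on the range of
    \<open>A\<close>.\<close>
  have absorb: "A * Q * (A * P) = A * P"
    if "is_core_inverse n A Q" "P \<in> carrier_mat n n" for P Q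
  proof -
    have Q: "Q \<in> carrier_mat n n" "A * Q * A = A"
      using that(1) by (auto simp: is_core_inverse_def)
    have "A * Q * (A * P) = A * Q * A * P"
      using A Q(1) that(2) by (simp add: assoc)
    with Q(2) show ?thesis
      by simp
  qed
  have Xc: "X \<in> carrier_mat n n" and X3: "dc_adjoint (A * X) = A * X"
    and Yc: "Y \<in> carrier_mat n n" and Y3: "dc_adjoint (A * Y) = A * Y"
    using X Y by (auto simp: is_core_inverse_def)
  \<comment> \<open>Taking adjoints reverses the product of the two projectors, so absorption can be
    used in both orders.\<close>
  have "A * X = dc_adjoint (A * Y * (A * X))"
    using absorb[OF Y Xc] X3 by simp
  also have "\<dots> = A * X * (A * Y)"
    using A Xc Yc X3 Y3 dc_adjoint_mult[of "A * Y" n n "A * X" n] by simp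
  finally have eq: "A * X = A * Y"
    using absorb[OF X Yc] by simp
  \<comment> \<open>\<open>A * (P * P) = P\<close> puts the columns of \<open>P\<close> into the
    range of \<open>A\<close>, where \<open>G * A\<close> is the identity because
    \<open>G * A * A = A * G * A = A\<close>.\<close>
  have recover: "P = G * (A * P)" if "is_core_inverse n A P" for P
  proof -
    have P: "P \<in> carrier_mat n n" "A * (P * P) = P"
      using that by (auto simp: is_core_inverse_def)
    have "G * (A * P) = G * (A * (A * (P * P)))"
      using P(2) by simp
    also have "\<dots> = (G * A) * A * (P * P)"
      using A Gc P(1) by (simp add: assoc)
    also have "\<dots> = P"
      using G1 G3 P(2) by simp
    finally show ?thesis
      by simp
  qed
  show ?thesis
    using recover[OF X] recover[OF Y] eq by simp
qed

text \<open>Existence and uniqueness justify the definite description, so equality with the inverse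
  becomes a check of equations on \<open>Y\<close>, later taken to be the matrix itself or its
  adjoint.\<close>

lemma dual_group_inverse_eq_iff:
  assumes A: "A \<in> carrier_mat n n" and G: "is_group_inverse n A G"
  shows "Y = dual_group_inverse A \<longleftrightarrow> is_group_inverse n A Y"
proof -
  have "dual_group_inverse A = (THE X. is_group_inverse n A X)"
    using A by (simp add: dual_group_inverse_def is_group_inverse_def)
  moreover have "(THE X. is_group_inverse n A X) = G"
    using G is_group_inverse_unique[OF A] by (intro the_equality)
  ultimately show ?thesis
    using G is_group_inverse_unique[OF A] by auto
qed

lemma dual_core_inverse_eq_iff:
  assumes A: "A \<in> carrier_mat n n" and G: "is_group_inverse n A G" and C: "is_core_inverse n A C"
  shows "Y = dual_core_inverse A \<longleftrightarrow> is_core_inverse n A Y"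
proof -
  have "dual_core_inverse A = (THE X. is_core_inverse n A X)"
    \<comment> \<open>The two predicates differ only in how the square of \<open>X\<close> is
      written.\<close>
    unfolding dual_core_inverse_def is_core_inverse_def
    using A by (intro arg_cong[where f = The] ext) (auto simp: pow_mat_two[where n = n])
  moreover have "(THE X. is_core_inverse n A X) = C"
    using C is_core_inverse_unique[OF A G] by (intro the_equality)
  ultimately show ?thesis
    using C is_core_inverse_unique[OF A G] by auto
qed

section \<open>Reduction to block matrices, explicit inverses and criteria\<close>

lemma is_group_inverse_unitary_conj:
  assumes U: "U \<in> dc_unitary n" and A: "A \<in> carrier_mat n n" and X: "X \<in> carrier_mat n n"
  shows "is_group_inverse n (unitary_conj U A) (unitary_conj U X) \<longleftrightarrow> is_group_inverse n A X"
  using assms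
  by (simp add: is_group_inverse_def unitary_conj_mult[OF U] unitary_conj_eq_iff[OF U])

lemma is_core_inverse_unitary_conj:
  assumes U: "U \<in> dc_unitary n" and A: "A \<in> carrier_mat n n" and X: "X \<in> carrier_mat n n"
  shows "is_core_inverse n (unitary_conj U A) (unitary_conj U X) \<longleftrightarrow> is_core_inverse n A X"
  using assms
  by (simp add: is_core_inverse_def unitary_conj_mult[OF U] unitary_conj_eq_iff[OF U]
      unitary_conj_adjoint[OF U])

text \<open>The product in either order has upper row \<open>1, T * C\<close>; the two factors
  \<open>T\<close> in the second block leave one after multiplication by \<open>B\<close> from the
  left.\<close>

lemma is_group_inverse_top_block:
  assumes B: "B \<in> carrier_mat r r" and C: "C \<in> carrier_mat r m"
    and T: "T \<in> carrier_mat r r" and BT: "B * T = 1\<^sub>m r" and TB: "T * B = 1\<^sub>m r"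
  shows "is_group_inverse (r + m) (top_block r m B C) (top_block r m T (T * (T * C)))"
proof -
  have "B * (T * (T * C)) = T * C"
    using B T C BT by (simp flip: assoc_mult_mat[of B r r T r "T * C" m])
  then show ?thesis
    using assms
    by (simp add: is_group_inverse_def top_block_mult_top_block)
qed

text \<open>With a zero second block the product is the Hermitian projector with upper row
  \<open>1, 0\<close>.\<close>

lemma is_core_inverse_top_block:
  assumes B: "B \<in> carrier_mat r r" and C: "C \<in> carrier_mat r m"
    and T: "T \<in> carrier_mat r r" and BT: "B * T = 1\<^sub>m r"
  shows "is_core_inverse (r + m) (top_block r m B C) (top_block r m T (0\<^sub>m r m))"
proof -
  have "B * (T * T) = T"
    using B T BT by (simp flip: assoc_mult_mat[of B r r T r T r])
  then show ?thesis
    using assms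
    by (auto simp: is_core_inverse_def top_block_mult_top_block dc_adjoint_top_block
        top_block_eq_left_block_iff eq_commute[of "left_block _ _ _ _"])
qed

text \<open>For a matrix paired with itself all conditions collapse to its cube being itself, that
  is, \<open>B * (B * B) = B\<close> and \<open>B * (B * C) = C\<close>. Cancelling \<open>B\<close>
  in the first gives \<open>B * B = 1\<close>, which implies the second.\<close>

lemma is_group_inverse_self_top_block_iff:
  assumes B: "B \<in> carrier_mat r r" and C: "C \<in> carrier_mat r m"
    and T: "T \<in> carrier_mat r r" and TB: "T * B = 1\<^sub>m r"
  shows "is_group_inverse (r + m) (top_block r m B C) (top_block r m B C) \<longleftrightarrow> B * B = 1\<^sub>m r"
proof -
  have "B * B = 1\<^sub>m r" if "B * (B * B) = B"
    using mult_left_cancel_mat[OF B T TB, of "B * B" r "1\<^sub>m r"] that B by simp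
  moreover have "B * (B * C) = C" if "B * B = 1\<^sub>m r"
    using assoc_mult_mat[OF B B C] that C by simp
  ultimately show ?thesis
    using assms
    by (auto simp: is_group_inverse_def top_block_mult_top_block top_block_eq_iff)
qed

text \<open>Besides the cubic equation, the square with upper row \<open>B * B, B * C\<close> must
  be Hermitian. This forces \<open>B * C = 0\<close>, and cancelling \<open>B\<close> leaves
  \<open>C = 0\<close>.\<close>

lemma is_core_inverse_self_top_block_iff:
  assumes B: "B \<in> carrier_mat r r" and C: "C \<in> carrier_mat r m"
    and T: "T \<in> carrier_mat r r" and TB: "T * B = 1\<^sub>m r"
  shows "is_core_inverse (r + m) (top_block r m B C) (top_block r m B C) \<longleftrightarrow>
    C = 0\<^sub>m r m \<and> B * B = 1\<^sub>m r" (is "?core \<longleftrightarrow> ?rhs")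
proof
  assume core: ?core
  then have "left_block r m (dc_adjoint (B * B)) (dc_adjoint (B * C)) =
      top_block r m (B * B) (B * C)" and eq: "B * (B * B) = B"
    using B C by (auto simp: is_core_inverse_def top_block_mult_top_block dc_adjoint_top_block
        top_block_eq_iff)
  then have "B * C = B * 0\<^sub>m r m"
    using B C top_block_eq_left_block_iff[of "B * B" r "B * C" m "dc_adjoint (B * B)" "dc_adjoint (B * C)"]
    by simp
  moreover have "B * (B * B) = B * 1\<^sub>m r"
    using eq B by simp
  ultimately show ?rhs
    using mult_left_cancel_mat[OF B T TB C, of "0\<^sub>m r m"]
      mult_left_cancel_mat[OF B T TB, of "B * B" r "1\<^sub>m r"] B by simp
next
  assume ?rhs
  then show ?core
    using assms
    by (auto simp: is_core_inverse_def top_block_mult_top_block dc_adjoint_top_block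
        top_block_eq_left_block_iff eq_commute[of "left_block _ _ _ _"])
qed

text \<open>Write M for the block matrix; M M^* has upper row \<open>N, 0\<close>. From M M^* M = M
  follows \<open>N * B = B\<close>, so \<open>N = 1\<close>; commutation of M with M^* kills
  \<open>C\<close>. Conversely, \<open>C = 0\<close> and \<open>N = 1\<close> make \<open>B\<close>
  unitary. In the application \<open>N\<close> is \<open>S * S\<close>.\<close>

lemma is_group_inverse_adjoint_top_block_iff:
  assumes B: "B \<in> carrier_mat r r" and C: "C \<in> carrier_mat r m"
    and T: "T \<in> carrier_mat r r" and BT: "B * T = 1\<^sub>m r" and TB: "T * B = 1\<^sub>m r"
    and N: "N = B * dc_adjoint B + C * dc_adjoint C"
  shows "is_group_inverse (r + m) (top_block r m B C) (dc_adjoint (top_block r m B C)) \<longleftrightarrow>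
    C = 0\<^sub>m r m \<and> N = 1\<^sub>m r" (is "?group \<longleftrightarrow> ?rhs")
proof
  let ?M = "top_block r m B C"
  have Nc: "N \<in> carrier_mat r r"
    using B C N by simp
  have MM: "?M * dc_adjoint ?M = top_block r m N (0\<^sub>m r m)"
    using B C by (simp add: N dc_adjoint_top_block top_block_mult_left_block)
  have MM': "dc_adjoint ?M * ?M =
      four_block_mat (dc_adjoint B * B) (dc_adjoint B * C) (dc_adjoint C * B) (dc_adjoint C * C)"
    using B C by (simp add: dc_adjoint_top_block left_block_mult_top_block)
  assume ?group
  note group = is_group_inverseD[OF this, unfolded MM MM']
  from group(2) have "top_block r m (N * B) (N * C) = top_block r m B C"
    by (simp only: top_block_mult_top_block[OF Nc zero_carrier_mat B C])
  then have NB: "N * B = 1\<^sub>m r * B"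
    using B C Nc by (simp add: top_block_eq_iff)
  \<comment> \<open>Blockwise comparison of both products; the lower left block gives an equation
    from which \<open>B\<close> can be cancelled on the right.\<close>
  have "N = dc_adjoint B * B \<and> 0\<^sub>m r m = dc_adjoint B * C \<and>
      0\<^sub>m m r = dc_adjoint C * B \<and> 0\<^sub>m m m = dc_adjoint C * C"
    by (rule four_block_mat_eq_iff[THEN iffD1, rotated -1, OF group(4)[unfolded top_block_def]])
      (use B C Nc in auto)
  then have "dc_adjoint C * B = 0\<^sub>m m r * B"
    unfolding left_mult_zero_mat[OF B] by (elim conjE) (rule sym)
  then have "dc_adjoint C = 0\<^sub>m m r"
    using mult_right_cancel_mat[OF B T BT, of "dc_adjoint C" m "0\<^sub>m m r"] C by simp
  then have "C = 0\<^sub>m r m"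
    by (metis dc_adjoint_adjoint dc_adjoint_zero)
  then show ?rhs
    using mult_right_cancel_mat[OF B T BT Nc _ NB] by simp
next
  assume ?rhs
  then have C0: "C = 0\<^sub>m r m" and BB: "B * dc_adjoint B = 1\<^sub>m r"
    using N B by auto
  then have BB': "dc_adjoint B * B = 1\<^sub>m r"
    using right_inverse_imp_left_inverse_mat[of B r "dc_adjoint B"] B by simp
  have "left_block r m (dc_adjoint B) (0\<^sub>m m r) = top_block r m (dc_adjoint B) (0\<^sub>m r m)"
    using B by (simp add: top_block_def left_block_def)
  with BB BB' C0 show ?group
    using B by (simp add: is_group_inverse_def dc_adjoint_top_block top_block_mult_top_block)
qed

text \<open>As for the group inverse, \<open>N * B = B\<close> gives \<open>N = 1\<close>. Here
  \<open>C\<close> vanishes because M M^* M^* = M^* has a zero lower block row on the left and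
  \<open>dc_adjoint C\<close> on the right. Conversely, \<open>dc_adjoint B\<close> serves as the
  right inverse \<open>T\<close> in \<open>is_core_inverse_top_block\<close>.\<close>

lemma is_core_inverse_adjoint_top_block_iff:
  assumes B: "B \<in> carrier_mat r r" and C: "C \<in> carrier_mat r m"
    and T: "T \<in> carrier_mat r r" and BT: "B * T = 1\<^sub>m r"
    and N: "N = B * dc_adjoint B + C * dc_adjoint C"
  shows "is_core_inverse (r + m) (top_block r m B C) (dc_adjoint (top_block r m B C)) \<longleftrightarrow>
    C = 0\<^sub>m r m \<and> N = 1\<^sub>m r" (is "?core \<longleftrightarrow> ?rhs")
proof
  let ?M = "top_block r m B C"
  have Nc: "N \<in> carrier_mat r r"
    using B C N by simp
  have M: "?M \<in> carrier_mat (r + m) (r + m)"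
    using B by simp
  have MM: "?M * dc_adjoint ?M = top_block r m N (0\<^sub>m r m)"
    using B C by (simp add: N dc_adjoint_top_block top_block_mult_left_block)
  assume core: ?core
  then have "top_block r m N (0\<^sub>m r m) * ?M = ?M"
    by (simp add: is_core_inverse_def MM)
  then have "top_block r m (N * B) (N * C) = top_block r m B C"
    by (simp only: top_block_mult_top_block[OF Nc zero_carrier_mat B C])
  then have NB: "N * B = 1\<^sub>m r * B"
    using B C Nc by (simp add: top_block_eq_iff)
  have "?M * dc_adjoint ?M * dc_adjoint ?M = dc_adjoint ?M"
    using core M by (simp add: is_core_inverse_def assoc_mult_mat[of _ "r + m" "r + m" _ "r + m" _ "r + m"])
  then have "top_block r m (N * dc_adjoint B) (0\<^sub>m r m) = left_block r m (dc_adjoint B) (dc_adjoint C)"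
    using B C Nc unfolding MM by (simp add: dc_adjoint_top_block top_block_mult_left_block)
  then have "dc_adjoint C = 0\<^sub>m m r"
    using B C Nc by (simp add: top_block_eq_left_block_iff)
  then have "C = 0\<^sub>m r m"
    by (metis dc_adjoint_adjoint dc_adjoint_zero)
  then show ?rhs
    using mult_right_cancel_mat[OF B T BT Nc _ NB] by simp
next
  assume ?rhs
  then have C0: "C = 0\<^sub>m r m" and BB: "B * dc_adjoint B = 1\<^sub>m r"
    using N B by auto
  have "is_core_inverse (r + m) (top_block r m B C) (top_block r m (dc_adjoint B) (0\<^sub>m r m))"
    using is_core_inverse_top_block[OF B C _ BB] B by simp
  moreover have "left_block r m (dc_adjoint B) (0\<^sub>m m r) = top_block r m (dc_adjoint B) (0\<^sub>m r m)"
    by (simp add: top_block_def left_block_def)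
  ultimately show ?core
    using B C0 by (simp add: dc_adjoint_top_block)
qed

section \<open>Invertibility of the leading block\<close>

text \<open>Each column of \<open>A\<close> is the image of a unit vector and so has a preimage
  under \<open>B\<close>; these preimages are the columns of \<open>Z\<close>.\<close>

lemma dc_range_subset_imp_factor:
  assumes A: "A \<in> carrier_mat n m" and B: "B \<in> carrier_mat n k" and sub: "dc_range A \<subseteq> dc_range B"
  obtains Z where "Z \<in> carrier_mat k m" "A = B * Z"
proof -
  have "\<exists>z. z \<in> carrier_vec k \<and> col A j = B *\<^sub>v z" if "j < m" for j
  proof -
    have "A *\<^sub>v unit_vec m j = col A j"
      using A that by (intro eq_vecI) (auto simp: row_def)
    then have "col A j \<in> dc_range A"
      using A by (auto simp: dc_range_def intro!: exI[of _ "unit_vec m j"])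
    then show ?thesis
      using sub B by (auto simp: dc_range_def)
  qed
  then obtain z where z: "z j \<in> carrier_vec k" "col A j = B *\<^sub>v z j" if "j < m" for j
    by metis
  define Z where "Z = mat_of_cols k (map z [0..<m])"
  have Z: "Z \<in> carrier_mat k m"
    by (simp add: Z_def mat_of_cols_def)
  moreover have "A = B * Z"
  proof (rule mat_col_eqI)
    fix j assume "j < dim_col (B * Z)"
    then have j: "j < m"
      using Z by simp
    then have "col (B * Z) j = B *\<^sub>v z j"
      using z[OF j] B Z by (subst col_mult2[OF B Z j]) (simp add: Z_def col_mat_of_cols)
    then show "col A j = col (B * Z) j"
      using z[OF j] by simp
  qed (use A B Z in auto)
  ultimately show thesis
    using that by blast
qed

text \<open>With \<open>W\<close> built from \<open>P\<close> and \<open>Q\<close>, the product M W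
  has upper left block 1. Substituting M = M M Z rewrites it as M (M (Z W)), whose upper left block
  is \<open>B\<close> times a square matrix. Thus \<open>B\<close> has a right inverse, which is
  two-sided.\<close>

lemma top_block_index_one_imp_invertible:
  fixes B :: "complex dual mat"
  assumes B: "B \<in> carrier_mat r r" and C: "C \<in> carrier_mat r m"
    and P: "P \<in> carrier_mat r r" and Q: "Q \<in> carrier_mat m r" and PQ: "B * P + C * Q = 1\<^sub>m r"
    and Z: "Z \<in> carrier_mat (r + m) (r + m)"
    and MZ: "top_block r m B C = top_block r m B C * top_block r m B C * Z"
  obtains T where "T \<in> carrier_mat r r" "B * T = 1\<^sub>m r" "T * B = 1\<^sub>m r"
proof -
  let ?M = "top_block r m B C" and ?W = "left_block r m P Q"
  note assoc = assoc_mult_mat[of _ "r + m" "r + m" _ "r + m" _ "r + m"]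
  have M: "?M \<in> carrier_mat (r + m) (r + m)" and W: "?W \<in> carrier_mat (r + m) (r + m)"
    using B P by auto
  obtain V1 V2 V3 V4 where split: "split_block (Z * ?W) r r = (V1, V2, V3, V4)"
    by (metis prod.exhaust)
  have "dim_row (Z * ?W) = r + m" "dim_col (Z * ?W) = r + m"
    using Z W by auto
  then have ZW: "Z * ?W = four_block_mat V1 V2 V3 V4"
    and V: "V1 \<in> carrier_mat r r" "V2 \<in> carrier_mat r m" "V3 \<in> carrier_mat m r" "V4 \<in> carrier_mat m m"
    using split_block[OF split, of m m] by blast+
  let ?T = "B * V1 + C * V3"
  have "top_block r m (1\<^sub>m r) (0\<^sub>m r m) = ?M * ?W"
    using B C P Q PQ by (simp add: top_block_mult_left_block)
  also have "\<dots> = ?M * ?M * Z * ?W"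
    using MZ by simp
  also have "\<dots> = ?M * (?M * (Z * ?W))"
    using M Z W by (simp add: assoc)
  also have "\<dots> = top_block r m (B * ?T) (B * (B * V2 + C * V4))"
    using B C V by (simp add: ZW top_block_mult_four_block top_block_mult_top_block)
  finally have "B * ?T = 1\<^sub>m r"
    using B C V by (simp add: top_block_eq_iff)
  moreover from this have "?T * B = 1\<^sub>m r"
    using right_inverse_imp_left_inverse_mat[OF B, of ?T] B C V by simp
  ultimately show thesis
    using that[of ?T] B C V by simp
qed

lemma mem_dc_CM_unitary_conj_imp_factor:
  assumes U: "U \<in> dc_unitary n" and M: "M \<in> carrier_mat n n" and CM: "unitary_conj U M \<in> dc_CM n"
  obtains Z where "Z \<in> carrier_mat n n" "M = M * M * Z"
proof -
  note U' = dc_unitaryD[OF U]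
  let ?A = "unitary_conj U M"
  have A: "?A \<in> carrier_mat n n"
    using U M by simp
  have "dc_range ?A \<subseteq> dc_range (?A * ?A)"
    using CM pow_mat_two[OF A] by (simp add: dc_CM_def)
  then obtain Y where Y: "Y \<in> carrier_mat n n" and AY: "?A = ?A * ?A * Y"
    using dc_range_subset_imp_factor[OF A, of "?A * ?A" n] A by auto
  \<comment> \<open>The factor \<open>Y\<close> found for the conjugated matrix is conjugated
    back.\<close>
  let ?Z = "dc_adjoint U * Y * U"
  have Z: "?Z \<in> carrier_mat n n"
    using U'(1) Y by simp
  have "unitary_conj U ?Z = (U * dc_adjoint U) * Y * (U * dc_adjoint U)"
    using U'(1) Y by (simp add: unitary_conj_def assoc_mult_mat[of _ n n _ n _ n])
  then have "unitary_conj U ?Z = Y"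
    using U' Y by simp
  then have "unitary_conj U M = unitary_conj U (M * M * ?Z)"
    using AY M Z by (metis unitary_conj_mult[OF U] mult_carrier_mat)
  then show thesis
    using that[OF Z] M Z by (simp add: unitary_conj_eq_iff[OF U])
qed

section \<open>Diagonal matrices of dual numbers\<close>

lemma dual_diag_carrier [simp]: "dual_diag r \<mu> \<in> carrier_mat r r"
  by (simp add: dual_diag_def)

lemma dc_adjoint_dual_diag [simp]: "dc_adjoint (dual_diag r \<mu>) = dual_diag r \<mu>"
proof -
  have "conjugate (map_dual complex_of_real x) = map_dual complex_of_real x" for x
    by (cases x) (simp add: conjugate_dual_def)
  then show ?thesis
    by (intro eq_matI) (auto simp: dc_adjoint_def dual_diag_def mat_diag_def)
qed

lemma dual_diag_invertible:
  assumes "\<And>i. i < r \<Longrightarrow> appreciable (\<mu> i)"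
  obtains T where "T \<in> carrier_mat r r" "dual_diag r \<mu> * T = 1\<^sub>m r" "T * dual_diag r \<mu> = 1\<^sub>m r"
proof -
  \<comment> \<open>\<open>(a + \<epsilon> b)\<^sup>-\<^sup>1 = 1 / a - \<epsilon> b / a\<^sup>2\<close>\<close>
  define \<nu> where "\<nu> i = Dual (1 / std_part (\<mu> i)) (- inf_part (\<mu> i) / (std_part (\<mu> i))\<^sup>2)" for i
  have "map_dual complex_of_real (\<mu> i) * map_dual complex_of_real (\<nu> i) = 1" if "i < r" for i
    using assms[OF that]
    by (simp add: \<nu>_def times_dual_def one_dual_def appreciable_def dual.map_sel power2_eq_square
        field_simps)
  then have "dual_diag r \<mu> * dual_diag r \<nu> = 1\<^sub>m r"
    unfolding dual_diag_def mat_diag_diag by (auto simp: mat_diag_def)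
  moreover from this have "dual_diag r \<nu> * dual_diag r \<mu> = 1\<^sub>m r"
    by (rule right_inverse_imp_left_inverse_mat[rotated 2]) auto
  ultimately show thesis
    using that by (metis dual_diag_carrier)
qed

text \<open>Entrywise, (a + eps b)^2 = a^2 + 2 eps a b equals 1 only for a = 1 or a = -1, with b =
  0; positivity excludes -1.\<close>

lemma dual_diag_square_eq_one_iff:
  assumes "\<And>i. i < r \<Longrightarrow> 0 < \<mu> i"
  shows "dual_diag r \<mu> * dual_diag r \<mu> = 1\<^sub>m r \<longleftrightarrow> dual_diag r \<mu> = 1\<^sub>m r"
proof
  assume eq: "dual_diag r \<mu> * dual_diag r \<mu> = 1\<^sub>m r"
  have "map_dual complex_of_real (\<mu> i) = 1" if i: "i < r" for i
  proof -
    have "(dual_diag r \<mu> * dual_diag r \<mu>) $$ (i, i) = 1"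
      using eq i by simp
    then have "map_dual complex_of_real (\<mu> i) * map_dual complex_of_real (\<mu> i) = 1"
      using i unfolding dual_diag_def mat_diag_diag by (simp add: mat_diag_def)
    then have sq: "complex_of_real (std_part (\<mu> i)) * complex_of_real (std_part (\<mu> i)) = 1"
      and inf: "std_part (\<mu> i) = 0 \<or> inf_part (\<mu> i) = 0"
      by (auto simp: times_dual_def one_dual_def dual.map_sel)
    have "std_part (\<mu> i) * std_part (\<mu> i) = 1"
      using sq by (metis of_real_mult of_real_eq_1_iff)
    \<comment> \<open>In the lexicographic order a positive dual number may have standard part 0, so
      only this weak bound is immediate; it suffices to exclude -1.\<close>
    moreover have "0 \<le> std_part (\<mu> i)"
      using assms[OF i] by (auto simp: less_dual_def less_eq_dual_def zero_dual_def)
    ultimately have "std_part (\<mu> i) = 1"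
      by (metis abs_of_nonneg mult_cancel_right1 square_eq_1_iff
          zero_le_one neg_0_le_iff_le not_one_le_zero)
    with inf show ?thesis
      by (cases "\<mu> i") (simp add: one_dual_def)
  qed
  then show "dual_diag r \<mu> = 1\<^sub>m r"
    by (auto simp: dual_diag_def mat_diag_def intro!: eq_matI)
qed simp

section \<open>Assembling the four equivalences\<close>

theorem theorem4p15:
  fixes A U S K L :: "complex dual mat" and \<mu> :: "nat \<Rightarrow> real dual" and n r :: nat
  assumes "A \<in> dc_CM n"
    and "r = dual_rank A"
    and "r \<le> n"
    and "U \<in> dc_unitary n"
    and "K \<in> carrier_mat r r"
    and "L \<in> carrier_mat r (n - r)"
    and "K * dc_adjoint K + L * dc_adjoint L = 1\<^sub>m r"
    and "\<And>i. i < r \<Longrightarrow> 0 < \<mu> i \<and> appreciable (\<mu> i)"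
    and "\<And>i j. i \<le> j \<Longrightarrow> j < r \<Longrightarrow> \<mu> j \<le> \<mu> i"
    and "S = dual_diag r \<mu>"
    and "A = U * four_block_mat (S * K) (S * L) (0\<^sub>m (n - r) r) (0\<^sub>m (n - r) (n - r))
               * dc_adjoint U"
  shows "(A = dual_group_inverse A \<longleftrightarrow> (S * K) ^\<^sub>m 2 = 1\<^sub>m r) \<and>
    (A = dual_core_inverse A \<longleftrightarrow> L = 0\<^sub>m r (n - r) \<and> (S * K) ^\<^sub>m 2 = 1\<^sub>m r) \<and>
    (dc_adjoint A = dual_group_inverse A \<longleftrightarrow> L = 0\<^sub>m r (n - r) \<and> S = 1\<^sub>m r) \<and>
    (dc_adjoint A = dual_core_inverse A \<longleftrightarrow> L = 0\<^sub>m r (n - r) \<and> S = 1\<^sub>m r)"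
proof -
  define m where "m = n - r"
  then have n: "n = r + m"
    using assms(3) by simp
  note U = assms(4) and K = assms(5) and KL = assms(7)
  have L: "L \<in> carrier_mat r m"
    using assms(6) m_def by simp
  have S: "S \<in> carrier_mat r r" and S_adj: "dc_adjoint S = S"
    using assms(10) by auto
  obtain R where R: "R \<in> carrier_mat r r" and SR: "S * R = 1\<^sub>m r" and RS: "R * S = 1\<^sub>m r"
    using dual_diag_invertible[of r \<mu>] assms(8,10) by blast
  define B C where "B = S * K" and "C = S * L"
  have B: "B \<in> carrier_mat r r" and C: "C \<in> carrier_mat r m"
    using S K L by (auto simp: B_def C_def)
  have C_zero: "C = 0\<^sub>m r m \<longleftrightarrow> L = 0\<^sub>m r m"
    using mult_left_cancel_mat[OF S R RS L, of "0\<^sub>m r m"] S by (auto simp: C_def)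
  \<comment> \<open>The relation between \<open>K\<close> and \<open>L\<close> is used with two
    choices of \<open>Y\<close>: \<open>S\<close> gives the identity for \<open>S * S\<close>, and
    the inverse \<open>R\<close> of \<open>S\<close> gives a right inverse of the block row
    \<open>B, C\<close>.\<close>
  have mult_KL: "B * (dc_adjoint K * Y) + C * (dc_adjoint L * Y) = S * Y"
    if Y: "Y \<in> carrier_mat r r" for Y
  proof -
    have "B * (dc_adjoint K * Y) + C * (dc_adjoint L * Y) =
        S * ((K * dc_adjoint K) * Y) + S * ((L * dc_adjoint L) * Y)"
      using S K L Y
      by (simp add: B_def C_def assoc_mult_mat[of _ r r _ r _ r] assoc_mult_mat[of _ r r _ m _ r]
          assoc_mult_mat[of _ r m _ r _ r])
    also have "\<dots> = S * ((K * dc_adjoint K + L * dc_adjoint L) * Y)"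
      using S K L Y by (simp add: mult_add_distrib_mat[of _ r r _ r] add_mult_distrib_mat[of _ r r _ _ r])
    finally show ?thesis
      using KL Y by simp
  qed
  have N: "S * S = B * dc_adjoint B + C * dc_adjoint C"
    using mult_KL[OF S] S K L S_adj
    by (simp add: B_def C_def dc_adjoint_mult[of _ r r])
  define M where "M = top_block r m B C"
  have M: "M \<in> carrier_mat n n"
    using B n by (simp add: M_def)
  have A: "A = unitary_conj U M"
    using assms(11) by (simp add: unitary_conj_def M_def top_block_def B_def C_def m_def)
  have A_carrier: "A \<in> carrier_mat n n"
    using A U M by simp
  obtain Z where Z: "Z \<in> carrier_mat n n" and MZ: "M = M * M * Z"
    using mem_dc_CM_unitary_conj_imp_factor[OF U M] assms(1) A by blast
  have "B * (dc_adjoint K * R) + C * (dc_adjoint L * R) = 1\<^sub>m r"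
    using mult_KL[OF R] SR by simp
  then obtain T where T: "T \<in> carrier_mat r r" and BT: "B * T = 1\<^sub>m r" and TB: "T * B = 1\<^sub>m r"
    using top_block_index_one_imp_invertible[OF B C, of "dc_adjoint K * R" "dc_adjoint L * R" Z]
      K L R Z MZ n unfolding M_def by auto
  \<comment> \<open>The closed forms serve as existence witnesses; the equivalences below check the
    defining equations instead of comparing with them.\<close>
  let ?G = "top_block r m T (T * (T * C))" and ?X = "top_block r m T (0\<^sub>m r m)"
  have G_block: "is_group_inverse n M ?G"
    using is_group_inverse_top_block[OF B C T BT TB] by (simp add: M_def n)
  have G: "is_group_inverse n A (unitary_conj U ?G)"
    using is_group_inverse_unitary_conj[OF U M is_group_inverseD(1)[OF G_block]] G_block A by blast
  have X_block: "is_core_inverse n M ?X"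
    using is_core_inverse_top_block[OF B C T BT] by (simp add: M_def n)
  have X: "is_core_inverse n A (unitary_conj U ?X)"
    using is_core_inverse_unitary_conj[OF U M is_core_inverseD(1)[OF X_block]] X_block A by blast
  have M_adj: "dc_adjoint M \<in> carrier_mat n n"
    using M by simp
  have A_adj: "dc_adjoint A = unitary_conj U (dc_adjoint M)"
    using A unitary_conj_adjoint[OF U M] by simp
  \<comment> \<open>The adjoint criteria yield \<open>S * S = 1\<close>; positivity of the diagonal
    reduces this to \<open>S = 1\<close>.\<close>
  have S_one: "S * S = 1\<^sub>m r \<longleftrightarrow> S = 1\<^sub>m r"
    unfolding assms(10) by (rule dual_diag_square_eq_one_iff) (simp add: assms(8))
  have BB: "(S * K) ^\<^sub>m 2 = B * B"
    using pow_mat_two[OF B] by (simp add: B_def)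
  \<comment> \<open>Each equivalence takes the same three stages: from the inverse to its equations,
    removal of the unitary conjugation, then the block criterion.\<close>
  have "A = dual_group_inverse A \<longleftrightarrow> (S * K) ^\<^sub>m 2 = 1\<^sub>m r"
    unfolding dual_group_inverse_eq_iff[OF A_carrier G] BB
    unfolding A is_group_inverse_unitary_conj[OF U M M]
    unfolding M_def n by (rule is_group_inverse_self_top_block_iff[OF B C T TB])
  moreover have "A = dual_core_inverse A \<longleftrightarrow> L = 0\<^sub>m r m \<and> (S * K) ^\<^sub>m 2 = 1\<^sub>m r"
    unfolding dual_core_inverse_eq_iff[OF A_carrier G X] BB C_zero[symmetric]
    unfolding A is_core_inverse_unitary_conj[OF U M M]
    unfolding M_def n by (rule is_core_inverse_self_top_block_iff[OF B C T TB])
  moreover have "dc_adjoint A = dual_group_inverse A \<longleftrightarrow> L = 0\<^sub>m r m \<and> S = 1\<^sub>m r"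
    unfolding dual_group_inverse_eq_iff[OF A_carrier G] C_zero[symmetric] S_one[symmetric] A_adj
    unfolding A is_group_inverse_unitary_conj[OF U M M_adj]
    unfolding M_def n by (rule is_group_inverse_adjoint_top_block_iff[OF B C T BT TB N])
  moreover have "dc_adjoint A = dual_core_inverse A \<longleftrightarrow> L = 0\<^sub>m r m \<and> S = 1\<^sub>m r"
    unfolding dual_core_inverse_eq_iff[OF A_carrier G X] C_zero[symmetric] S_one[symmetric] A_adj
    unfolding A is_core_inverse_unitary_conj[OF U M M_adj]
    unfolding M_def n by (rule is_core_inverse_adjoint_top_block_iff[OF B C T BT N])
  ultimately show ?thesis
    unfolding m_def by blast
qed

end
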